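(* Let $\tau$ be the translation of the language $\{\bot,\langle\cdot,\cdot\rangle,\sqsubseteq\}$ of the tree theory $\mathsf{T}$ into the language $L=\{\emptyset,\langle\cdot\rangle,\uplus,\sqsubseteq\}$ given by: domain $\delta(x):=(x=x)$; equality translated as equality; $\bot$ translated by the term $\emptyset$; $\langle x,y\rangle$ translated by the term $\pi(x,y):=\langle x\rangle\uplus(\langle x\rangle\uplus\langle y\rangle)$; and $x\sqsubseteq y$ translated by the atomic formula $x\sqsubseteq y$. Then $\mathsf{F}^{-}$ proves the $\tau$-translations of the axioms $\mathsf{T}_1$–$\mathsf{T}_4$ of $\mathsf{T}$. Hence $\tau$ is a direct interpretation of $\mathsf{T}$ in $\mathsf{F}^{-}$, and $\mathsf{T}$ is interpretable in $\mathsf{F}^{-}$.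
   Context: An interpretation of a theory $V$ in a theory $U$ is a translation $\tau$ (domain formula $\delta$ provably nonempty in $U$, formulas for the relation symbols, formulas provably total and functional on $\delta$ for the function symbols; quantifiers relativized to $\delta$) such that $U$ proves the translation of every axiom of $V$. It is direct if $\delta(x):=(x=x)$, equality is translated as equality, and function symbols are translated by terms. **The theory $\mathsf{T}$** (language: constant $\bot$, binary function symbol $\langle\cdot,\cdot\rangle$, binary relation symbol $\sqsubseteq$): $\mathsf{T}_1$: $\forall x,y\;\neg(\langle x,y\rangle=\bot)$; $\mathsf{T}_2$: $\forall x,y,z,w\;(\langle x,y\rangle=\langle z,w\rangle\rightarrow x=z\wedge y=w)$; $\mathsf{T}_3$: $\forall x\;(x\sqsubseteq\bot\leftrightarrow x=\bot)$; $\mathsf{T}_4$: $\forall x,y,z\;(x\sqsubseteq\langle y,z\rangle\leftrightarrow x=\langle y,z\rangle\vee x\sqsubseteq y\vee x\sqsubseteq z)$. **The theory $\mathsf{F}^{-}$** (language $L$: constant $\emptyset$, unary function $\langle\cdot\rangle$, binary function $\uplus$, binary relation $\sqsubseteq$; axioms universally quantified): $\mathrm{F}_1$: $(x\uplus y)\uplus z=x\uplus(y\uplus z)$; $\mathrm{F}_2$: $x\uplus y=y\uplus x$; $\mathrm{F}_3$: $x\uplus\emptyset=x$; $\mathrm{F}_4$: $x\uplus z=y\uplus z\rightarrow x=y$; $\mathrm{F}_5$: $\langle x\rangle\ne\emptyset$; $\mathrm{F}_6$: $x\uplus y=\emptyset\rightarrow x=\emptyset$; $\mathrm{F}_7$: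 $\langle x\rangle=\langle y\rangle\rightarrow x=y$; $\mathrm{F}_8$: $u\uplus v=\langle x\rangle\uplus w\rightarrow\exists w'\,(u=\langle x\rangle\uplus w'\vee v=\langle x\rangle\uplus w')$; $\mathrm{F}_9$: $x\sqsubseteq t\leftrightarrow\bigl(x=t\vee\exists w\,\exists u\,(t=w\uplus\langle u\rangle\wedge x\sqsubseteq u)\bigr)$. *)

theory Defs
  imports Main
begin

section \<open>First-order logic with equality\<close>

text \<open>
  Variables are de Bruijn indices. Symbols carry their arity in the theory record below; a formula
  belongs to the language of a theory iff \<open>fm_in\<close> holds, which demands that every symbol is
  applied to the right number of arguments.
\<close>

datatype 'f tm = Var nat | Fn 'f "'f tm list"

datatype ('f, 'r) fm =
    Bot
  | Eq "'f tm" "'f tm"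
  | Rel 'r "'f tm list"
  | Imp "('f, 'r) fm" "('f, 'r) fm"
  | Conj "('f, 'r) fm" "('f, 'r) fm"
  | Disj "('f, 'r) fm" "('f, 'r) fm"
  | All "('f, 'r) fm"
  | Ex "('f, 'r) fm"

abbreviation Neg :: "('f, 'r) fm \<Rightarrow> ('f, 'r) fm" where
  "Neg p \<equiv> Imp p Bot"

abbreviation Iff :: "('f, 'r) fm \<Rightarrow> ('f, 'r) fm \<Rightarrow> ('f, 'r) fm" where
  "Iff p q \<equiv> Conj (Imp p q) (Imp q p)"

definition Conjs :: "('f, 'r) fm list \<Rightarrow> ('f, 'r) fm" where
  "Conjs ps = foldr Conj ps (Neg Bot)"

definition Alls :: "nat \<Rightarrow> ('f, 'r) fm \<Rightarrow> ('f, 'r) fm" where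
  "Alls n p = (All ^^ n) p"

definition Exs :: "nat \<Rightarrow> ('f, 'r) fm \<Rightarrow> ('f, 'r) fm" where
  "Exs n p = (Ex ^^ n) p"

primrec fv_tm :: "'f tm \<Rightarrow> nat set" where
  "fv_tm (Var i) = {i}"
| "fv_tm (Fn f ts) = \<Union> (set (map fv_tm ts))"

primrec fv_fm :: "('f, 'r) fm \<Rightarrow> nat set" where
  "fv_fm Bot = {}"
| "fv_fm (Eq s t) = fv_tm s \<union> fv_tm t"
| "fv_fm (Rel r ts) = \<Union> (set (map fv_tm ts))"
| "fv_fm (Imp p q) = fv_fm p \<union> fv_fm q"
| "fv_fm (Conj p q) = fv_fm p \<union> fv_fm q"
| "fv_fm (Disj p q) = fv_fm p \<union> fv_fm q"
| "fv_fm (All p) = {i. Suc i \<in> fv_fm p}"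
| "fv_fm (Ex p) = {i. Suc i \<in> fv_fm p}"

text \<open>Simultaneous, capture-avoiding substitution.\<close>

primrec subst_tm :: "(nat \<Rightarrow> 'f tm) \<Rightarrow> 'f tm \<Rightarrow> 'f tm" where
  "subst_tm \<sigma> (Var i) = \<sigma> i"
| "subst_tm \<sigma> (Fn f ts) = Fn f (map (subst_tm \<sigma>) ts)"

definition up :: "(nat \<Rightarrow> 'f tm) \<Rightarrow> nat \<Rightarrow> 'f tm" where
  "up \<sigma> i = (case i of 0 \<Rightarrow> Var 0 | Suc j \<Rightarrow> subst_tm (\<lambda>k. Var (Suc k)) (\<sigma> j))"

primrec subst_fm :: "(nat \<Rightarrow> 'f tm) \<Rightarrow> ('f, 'r) fm \<Rightarrow> ('f, 'r) fm" where
  "subst_fm \<sigma> Bot = Bot"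
| "subst_fm \<sigma> (Eq s t) = Eq (subst_tm \<sigma> s) (subst_tm \<sigma> t)"
| "subst_fm \<sigma> (Rel r ts) = Rel r (map (subst_tm \<sigma>) ts)"
| "subst_fm \<sigma> (Imp p q) = Imp (subst_fm \<sigma> p) (subst_fm \<sigma> q)"
| "subst_fm \<sigma> (Conj p q) = Conj (subst_fm \<sigma> p) (subst_fm \<sigma> q)"
| "subst_fm \<sigma> (Disj p q) = Disj (subst_fm \<sigma> p) (subst_fm \<sigma> q)"
| "subst_fm \<sigma> (All p) = All (subst_fm (up \<sigma>) p)"
| "subst_fm \<sigma> (Ex p) = Ex (subst_fm (up \<sigma>) p)"

definition lift_fm :: "('f, 'r) fm \<Rightarrow> ('f, 'r) fm" where
  "lift_fm = subst_fm (\<lambda>i. Var (Suc i))"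

text \<open>\<open>inst t p\<close> replaces variable 0 by \<open>t\<close> and lowers the remaining free variables.\<close>

definition inst :: "'f tm \<Rightarrow> ('f, 'r) fm \<Rightarrow> ('f, 'r) fm" where
  "inst t = subst_fm (\<lambda>i. case i of 0 \<Rightarrow> t | Suc j \<Rightarrow> Var j)"

definition args :: "'f tm list \<Rightarrow> nat \<Rightarrow> 'f tm" where
  "args ts i = (if i < length ts then ts ! i else Var i)"

record ('f, 'r) fo_theory =
  farity :: "'f \<Rightarrow> nat"
  rarity :: "'r \<Rightarrow> nat"
  axioms :: "('f, 'r) fm set"

primrec tm_in :: "('f, 'r) fo_theory \<Rightarrow> 'f tm \<Rightarrow> bool" where
  "tm_in U (Var i) = True"
| "tm_in U (Fn f ts) = (length ts = farity U f \<and> list_all id (map (tm_in U) ts))"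

primrec fm_in :: "('f, 'r) fo_theory \<Rightarrow> ('f, 'r) fm \<Rightarrow> bool" where
  "fm_in U Bot = True"
| "fm_in U (Eq s t) = (tm_in U s \<and> tm_in U t)"
| "fm_in U (Rel r ts) = (length ts = rarity U r \<and> list_all (tm_in U) ts)"
| "fm_in U (Imp p q) = (fm_in U p \<and> fm_in U q)"
| "fm_in U (Conj p q) = (fm_in U p \<and> fm_in U q)"
| "fm_in U (Disj p q) = (fm_in U p \<and> fm_in U q)"
| "fm_in U (All p) = fm_in U p"
| "fm_in U (Ex p) = fm_in U p"

text \<open>
  Classical natural deduction with equality. The side conditions \<open>tm_in\<close> and \<open>fm_in\<close> keep the
  whole derivation inside the language of \<open>U\<close>; the axioms of \<open>U\<close> enter only through \<open>proves\<close>.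
\<close>

inductive deriv :: "('f, 'r) fo_theory \<Rightarrow> ('f, 'r) fm set \<Rightarrow> ('f, 'r) fm \<Rightarrow> bool"
  for U :: "('f, 'r) fo_theory" where
  Assm: "p \<in> \<Gamma> \<Longrightarrow> fm_in U p \<Longrightarrow> deriv U \<Gamma> p"
| ImpI: "fm_in U p \<Longrightarrow> deriv U (insert p \<Gamma>) q \<Longrightarrow> deriv U \<Gamma> (Imp p q)"
| ImpE: "deriv U \<Gamma> (Imp p q) \<Longrightarrow> deriv U \<Gamma> p \<Longrightarrow> deriv U \<Gamma> q"
| ConjI: "deriv U \<Gamma> p \<Longrightarrow> deriv U \<Gamma> q \<Longrightarrow> deriv U \<Gamma> (Conj p q)"
| ConjE1: "deriv U \<Gamma> (Conj p q) \<Longrightarrow> deriv U \<Gamma> p"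
| ConjE2: "deriv U \<Gamma> (Conj p q) \<Longrightarrow> deriv U \<Gamma> q"
| DisjI1: "fm_in U q \<Longrightarrow> deriv U \<Gamma> p \<Longrightarrow> deriv U \<Gamma> (Disj p q)"
| DisjI2: "fm_in U p \<Longrightarrow> deriv U \<Gamma> q \<Longrightarrow> deriv U \<Gamma> (Disj p q)"
| DisjE: "deriv U \<Gamma> (Disj p q) \<Longrightarrow> deriv U (insert p \<Gamma>) r \<Longrightarrow> deriv U (insert q \<Gamma>) r
    \<Longrightarrow> deriv U \<Gamma> r"
| Raa: "fm_in U p \<Longrightarrow> deriv U (insert (Neg p) \<Gamma>) Bot \<Longrightarrow> deriv U \<Gamma> p"
| AllI: "deriv U (lift_fm ` \<Gamma>) p \<Longrightarrow> deriv U \<Gamma> (All p)"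
| AllE: "tm_in U t \<Longrightarrow> deriv U \<Gamma> (All p) \<Longrightarrow> deriv U \<Gamma> (inst t p)"
| ExI: "fm_in U p \<Longrightarrow> tm_in U t \<Longrightarrow> deriv U \<Gamma> (inst t p) \<Longrightarrow> deriv U \<Gamma> (Ex p)"
| ExE: "deriv U \<Gamma> (Ex p) \<Longrightarrow> deriv U (insert p (lift_fm ` \<Gamma>)) (lift_fm q) \<Longrightarrow> deriv U \<Gamma> q"
| EqI: "tm_in U t \<Longrightarrow> deriv U \<Gamma> (Eq t t)"
| EqE: "fm_in U p \<Longrightarrow> deriv U \<Gamma> (Eq s t) \<Longrightarrow> deriv U \<Gamma> (inst s p) \<Longrightarrow> deriv U \<Gamma> (inst t p)"

definition proves :: "('f, 'r) fo_theory \<Rightarrow> ('f, 'r) fm \<Rightarrow> bool" where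
  "proves U p = deriv U (axioms U) p"

section \<open>Translations and interpretations\<close>

text \<open>
  A one-dimensional, parameter-free translation of a language with function symbols \<open>'f\<close> and
  relation symbols \<open>'r\<close> into one with symbols \<open>'g\<close> and \<open>'s\<close>. The variables of the component
  formulas are positional: \<open>tdom\<close> speaks about variable 0, \<open>teq\<close> about 0 and 1, \<open>trel r\<close> about
  \<open>0, \<dots>, n - 1\<close> for \<open>r\<close> of arity \<open>n\<close>, and \<open>tfun f\<close> for \<open>f\<close> of arity \<open>n\<close> is the graph formula with
  arguments \<open>0, \<dots>, n - 1\<close> and value \<open>n\<close>.
\<close>

record ('f, 'r, 'g, 's) translation =
  tdom :: "('g, 's) fm"
  teq :: "('g, 's) fm"
  tfun :: "'f \<Rightarrow> ('g, 's) fm"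
  trel :: "'r \<Rightarrow> ('g, 's) fm"

definition app :: "('g, 's) fm \<Rightarrow> nat list \<Rightarrow> ('g, 's) fm" where
  "app p xs = subst_fm (args (map Var xs)) p"

definition in_dom :: "('f, 'r, 'g, 's) translation \<Rightarrow> nat list \<Rightarrow> ('g, 's) fm" where
  "in_dom \<tau> xs = Conjs (map (\<lambda>x. app (tdom \<tau>) [x]) xs)"

text \<open>
  \<open>val \<tau> t k y\<close> says that variable \<open>y\<close> is a value of the source term \<open>t\<close>, at a place where \<open>k\<close>
  auxiliary quantifiers (whose variables do not occur in \<open>t\<close>) have been inserted. For a compound
  term it reads: there are \<open>z\<^sub>0, \<dots>, z\<^bsub>n-1\<^esub>\<close> in the domain such that each \<open>z\<^sub>i\<close> is a value of the
  \<open>i\<close>-th argument and \<open>tfun f\<close> holds of \<open>z\<^sub>0, \<dots>, z\<^bsub>n-1\<^esub>, y\<close>.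
\<close>

primrec val :: "('f, 'r, 'g, 's) translation \<Rightarrow> 'f tm \<Rightarrow> nat \<Rightarrow> nat \<Rightarrow> ('g, 's) fm" where
  "val \<tau> (Var i) = (\<lambda>k y. app (teq \<tau>) [i + k, y])"
| "val \<tau> (Fn f ts) = (\<lambda>k y. let n = length ts in
     Exs n (Conj (in_dom \<tau> [0..<n])
       (Conj (Conjs (map2 (\<lambda>v i. v (k + n) i) (map (val \<tau>) ts) [0..<n]))
         (app (tfun \<tau> f) ([0..<n] @ [y + n])))))"

text \<open>The same unnesting for an atomic formula with arguments \<open>ts\<close> and translated predicate \<open>p\<close>.\<close>

definition tr_atom ::
  "('f, 'r, 'g, 's) translation \<Rightarrow> ('g, 's) fm \<Rightarrow> 'f tm list \<Rightarrow> ('g, 's) fm" where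
  "tr_atom \<tau> p ts = (let n = length ts in
     Exs n (Conj (in_dom \<tau> [0..<n])
       (Conj (Conjs (map2 (\<lambda>t i. val \<tau> t n i) ts [0..<n])) (app p [0..<n]))))"

primrec tr :: "('f, 'r, 'g, 's) translation \<Rightarrow> ('f, 'r) fm \<Rightarrow> ('g, 's) fm" where
  "tr \<tau> Bot = Bot"
| "tr \<tau> (Eq s t) = tr_atom \<tau> (teq \<tau>) [s, t]"
| "tr \<tau> (Rel r ts) = tr_atom \<tau> (trel \<tau> r) ts"
| "tr \<tau> (Imp p q) = Imp (tr \<tau> p) (tr \<tau> q)"
| "tr \<tau> (Conj p q) = Conj (tr \<tau> p) (tr \<tau> q)"
| "tr \<tau> (Disj p q) = Disj (tr \<tau> p) (tr \<tau> q)"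
| "tr \<tau> (All p) = All (Imp (app (tdom \<tau>) [0]) (tr \<tau> p))"
| "tr \<tau> (Ex p) = Ex (Conj (app (tdom \<tau>) [0]) (tr \<tau> p))"

definition translation_ok ::
  "('f, 'r, 'g, 's) translation \<Rightarrow> ('f, 'r) fo_theory \<Rightarrow> ('g, 's) fo_theory \<Rightarrow> bool" where
  "translation_ok \<tau> V U \<longleftrightarrow>
     fm_in U (tdom \<tau>) \<and> fv_fm (tdom \<tau>) \<subseteq> {0} \<and>
     fm_in U (teq \<tau>) \<and> fv_fm (teq \<tau>) \<subseteq> {0, 1} \<and>
     (\<forall>f. fm_in U (tfun \<tau> f) \<and> fv_fm (tfun \<tau> f) \<subseteq> {..farity V f}) \<and>
     (\<forall>r. fm_in U (trel \<tau> r) \<and> fv_fm (trel \<tau> r) \<subseteq> {..<rarity V r})"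

text \<open>
  Since \<open>teq\<close> may be any formula, the logical axioms for equality of the source language count
  among the axioms whose translations have to be proved. They are stated on the component formulas:
  \<open>teq\<close> is an equivalence relation on the domain and a congruence for every \<open>trel r\<close> and \<open>tfun f\<close>.
\<close>

definition congruence :: "('f, 'r, 'g, 's) translation \<Rightarrow> nat \<Rightarrow> ('g, 's) fm \<Rightarrow> ('g, 's) fm" where
  "congruence \<tau> n p =
     Alls (2 * n) (Imp (in_dom \<tau> [0..<2 * n])
       (Imp (Conjs (map (\<lambda>i. app (teq \<tau>) [i, n + i]) [0..<n]))
         (Imp (app p [0..<n]) (app p [n..<2 * n]))))"

definition equality_ok ::
  "('f, 'r, 'g, 's) translation \<Rightarrow> ('f, 'r) fo_theory \<Rightarrow> ('g, 's) fo_theory \<Rightarrow> bool" where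
  "equality_ok \<tau> V U \<longleftrightarrow>
     proves U (Alls 1 (Imp (in_dom \<tau> [0]) (app (teq \<tau>) [0, 0]))) \<and>
     proves U (Alls 2 (Imp (in_dom \<tau> [0, 1])
       (Imp (app (teq \<tau>) [0, 1]) (app (teq \<tau>) [1, 0])))) \<and>
     proves U (Alls 3 (Imp (in_dom \<tau> [0, 1, 2])
       (Imp (Conj (app (teq \<tau>) [0, 1]) (app (teq \<tau>) [1, 2])) (app (teq \<tau>) [0, 2])))) \<and>
     (\<forall>r. proves U (congruence \<tau> (rarity V r) (trel \<tau> r))) \<and>
     (\<forall>f. proves U (congruence \<tau> (Suc (farity V f)) (tfun \<tau> f)))"

definition fun_total :: "('f, 'r, 'g, 's) translation \<Rightarrow> nat \<Rightarrow> ('g, 's) fm \<Rightarrow> ('g, 's) fm" where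
  "fun_total \<tau> n p =
     Alls n (Imp (in_dom \<tau> [0..<n])
       (Ex (Conj (app (tdom \<tau>) [0]) (app p ([1..<Suc n] @ [0])))))"

definition fun_unique :: "('f, 'r, 'g, 's) translation \<Rightarrow> nat \<Rightarrow> ('g, 's) fm \<Rightarrow> ('g, 's) fm" where
  "fun_unique \<tau> n p =
     Alls (n + 2) (Imp (in_dom \<tau> [0..<n + 2])
       (Imp (Conj (app p ([0..<n] @ [n])) (app p ([0..<n] @ [n + 1])))
         (app (teq \<tau>) [n, n + 1])))"

definition interpretation_of ::
  "('f, 'r, 'g, 's) translation \<Rightarrow> ('f, 'r) fo_theory \<Rightarrow> ('g, 's) fo_theory \<Rightarrow> bool" where
  "interpretation_of \<tau> V U \<longleftrightarrow>
     translation_ok \<tau> V U \<and>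
     proves U (Ex (tdom \<tau>)) \<and>
     (\<forall>f. proves U (fun_total \<tau> (farity V f) (tfun \<tau> f)) \<and>
          proves U (fun_unique \<tau> (farity V f) (tfun \<tau> f))) \<and>
     equality_ok \<tau> V U \<and>
     (\<forall>p \<in> axioms V. proves U (tr \<tau> p))"

definition direct ::
  "('f, 'r, 'g, 's) translation \<Rightarrow> ('f, 'r) fo_theory \<Rightarrow> ('g, 's) fo_theory \<Rightarrow> bool" where
  "direct \<tau> V U \<longleftrightarrow>
     tdom \<tau> = Eq (Var 0) (Var 0) \<and>
     teq \<tau> = Eq (Var 0) (Var 1) \<and>
     (\<forall>f. \<exists>t. tm_in U t \<and> fv_tm t \<subseteq> {..<farity V f} \<and> tfun \<tau> f = Eq (Var (farity V f)) t)"

definition direct_interpretation_of ::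
  "('f, 'r, 'g, 's) translation \<Rightarrow> ('f, 'r) fo_theory \<Rightarrow> ('g, 's) fo_theory \<Rightarrow> bool" where
  "direct_interpretation_of \<tau> V U \<longleftrightarrow> interpretation_of \<tau> V U \<and> direct \<tau> V U"

definition interpretable :: "('f, 'r) fo_theory \<Rightarrow> ('g, 's) fo_theory \<Rightarrow> bool" where
  "interpretable V U \<longleftrightarrow> (\<exists>\<tau>. interpretation_of \<tau> V U)"

text \<open>
  A direct translation is given by a term \<open>F f\<close> for each function symbol and a formula \<open>R r\<close> for each
  relation symbol. It translates formulas by replacing symbols inside terms, without unnesting
  (\<open>direct_tr\<close>), and it induces a translation in the general sense, with the graphs \<open>y = F f\<close> as
  function formulas (\<open>direct_translation\<close>).
\<close>

primrec direct_tm :: "('f \<Rightarrow> 'g tm) \<Rightarrow> 'f tm \<Rightarrow> 'g tm" where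
  "direct_tm F (Var i) = Var i"
| "direct_tm F (Fn f ts) = subst_tm (args (map (direct_tm F) ts)) (F f)"

primrec direct_tr ::
  "('f \<Rightarrow> 'g tm) \<Rightarrow> ('r \<Rightarrow> ('g, 's) fm) \<Rightarrow> ('f, 'r) fm \<Rightarrow> ('g, 's) fm" where
  "direct_tr F R Bot = Bot"
| "direct_tr F R (Eq s t) = Eq (direct_tm F s) (direct_tm F t)"
| "direct_tr F R (Rel r ts) = subst_fm (args (map (direct_tm F) ts)) (R r)"
| "direct_tr F R (Imp p q) = Imp (direct_tr F R p) (direct_tr F R q)"
| "direct_tr F R (Conj p q) = Conj (direct_tr F R p) (direct_tr F R q)"
| "direct_tr F R (Disj p q) = Disj (direct_tr F R p) (direct_tr F R q)"
| "direct_tr F R (All p) = All (Imp (Eq (Var 0) (Var 0)) (direct_tr F R p))"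
| "direct_tr F R (Ex p) = Ex (Conj (Eq (Var 0) (Var 0)) (direct_tr F R p))"

definition direct_translation ::
  "('f \<Rightarrow> nat) \<Rightarrow> ('f \<Rightarrow> 'g tm) \<Rightarrow> ('r \<Rightarrow> ('g, 's) fm) \<Rightarrow> ('f, 'r, 'g, 's) translation" where
  "direct_translation ar F R =
     \<lparr>tdom = Eq (Var 0) (Var 0), teq = Eq (Var 0) (Var 1),
      tfun = (\<lambda>f. Eq (Var (ar f)) (F f)), trel = R\<rparr>"

section \<open>The tree theory\<close>

datatype t_fun = TBot | TPair
datatype t_rel = TSub

abbreviation t_bot :: "t_fun tm" where "t_bot \<equiv> Fn TBot []"
abbreviation t_pair :: "t_fun tm \<Rightarrow> t_fun tm \<Rightarrow> t_fun tm" where "t_pair s t \<equiv> Fn TPair [s, t]"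
abbreviation t_sub :: "t_fun tm \<Rightarrow> t_fun tm \<Rightarrow> (t_fun, t_rel) fm" where
  "t_sub s t \<equiv> Rel TSub [s, t]"

text \<open>In a quantifier prefix the innermost variable has index 0.\<close>

definition T1 :: "(t_fun, t_rel) fm" where
  "T1 = Alls 2 (let x = Var 1; y = Var 0 in Neg (Eq (t_pair x y) t_bot))"

definition T2 :: "(t_fun, t_rel) fm" where
  "T2 = Alls 4 (let x = Var 3; y = Var 2; z = Var 1; w = Var 0 in
     Imp (Eq (t_pair x y) (t_pair z w)) (Conj (Eq x z) (Eq y w)))"

definition T3 :: "(t_fun, t_rel) fm" where
  "T3 = Alls 1 (let x = Var 0 in Iff (t_sub x t_bot) (Eq x t_bot))"

definition T4 :: "(t_fun, t_rel) fm" where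
  "T4 = Alls 3 (let x = Var 2; y = Var 1; z = Var 0 in
     Iff (t_sub x (t_pair y z)) (Disj (Eq x (t_pair y z)) (Disj (t_sub x y) (t_sub x z))))"

definition theory_T :: "(t_fun, t_rel) fo_theory" where
  "theory_T = \<lparr>farity = (\<lambda>f. case f of TBot \<Rightarrow> 0 | TPair \<Rightarrow> 2), rarity = (\<lambda>_. 2),
     axioms = {T1, T2, T3, T4}\<rparr>"

section \<open>The theory \<open>F\<^sup>-\<close>\<close>

datatype f_fun = FEmp | FSing | FUn
datatype f_rel = FSub

abbreviation f_emp :: "f_fun tm" where "f_emp \<equiv> Fn FEmp []"
abbreviation f_sing :: "f_fun tm \<Rightarrow> f_fun tm" where "f_sing t \<equiv> Fn FSing [t]"
abbreviation f_un :: "f_fun tm \<Rightarrow> f_fun tm \<Rightarrow> f_fun tm" where "f_un s t \<equiv> Fn FUn [s, t]"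
abbreviation f_sub :: "f_fun tm \<Rightarrow> f_fun tm \<Rightarrow> (f_fun, f_rel) fm" where
  "f_sub s t \<equiv> Rel FSub [s, t]"

definition F1 :: "(f_fun, f_rel) fm" where
  "F1 = Alls 3 (let x = Var 2; y = Var 1; z = Var 0 in
     Eq (f_un (f_un x y) z) (f_un x (f_un y z)))"

definition F2 :: "(f_fun, f_rel) fm" where
  "F2 = Alls 2 (let x = Var 1; y = Var 0 in Eq (f_un x y) (f_un y x))"

definition F3 :: "(f_fun, f_rel) fm" where
  "F3 = Alls 1 (let x = Var 0 in Eq (f_un x f_emp) x)"

definition F4 :: "(f_fun, f_rel) fm" where
  "F4 = Alls 3 (let x = Var 2; y = Var 1; z = Var 0 in
     Imp (Eq (f_un x z) (f_un y z)) (Eq x y))"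

definition F5 :: "(f_fun, f_rel) fm" where
  "F5 = Alls 1 (let x = Var 0 in Neg (Eq (f_sing x) f_emp))"

definition F6 :: "(f_fun, f_rel) fm" where
  "F6 = Alls 2 (let x = Var 1; y = Var 0 in Imp (Eq (f_un x y) f_emp) (Eq x f_emp))"

definition F7 :: "(f_fun, f_rel) fm" where
  "F7 = Alls 2 (let x = Var 1; y = Var 0 in Imp (Eq (f_sing x) (f_sing y)) (Eq x y))"

text \<open>The existential quantifiers in the next two axioms shift the indices of the outer variables.\<close>

definition F8 :: "(f_fun, f_rel) fm" where
  "F8 = Alls 4 (Imp
     (let u = Var 3; v = Var 2; x = Var 1; w = Var 0 in Eq (f_un u v) (f_un (f_sing x) w))
     (Ex (let u = Var 4; v = Var 3; x = Var 2; w' = Var 0 in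
       Disj (Eq u (f_un (f_sing x) w')) (Eq v (f_un (f_sing x) w')))))"

definition F9 :: "(f_fun, f_rel) fm" where
  "F9 = Alls 2 (Iff
     (let x = Var 1; t = Var 0 in f_sub x t)
     (Disj (let x = Var 1; t = Var 0 in Eq x t)
       (Ex (Ex (let x = Var 3; t = Var 2; w = Var 1; u = Var 0 in
         Conj (Eq t (f_un w (f_sing u))) (f_sub x u))))))"

definition theory_Fminus :: "(f_fun, f_rel) fo_theory" where
  "theory_Fminus =
     \<lparr>farity = (\<lambda>f. case f of FEmp \<Rightarrow> 0 | FSing \<Rightarrow> 1 | FUn \<Rightarrow> 2), rarity = (\<lambda>_. 2),
      axioms = {F1, F2, F3, F4, F5, F6, F7, F8, F9}\<rparr>"

section \<open>The translation\<close>

definition pi_tm :: "f_fun tm \<Rightarrow> f_fun tm \<Rightarrow> f_fun tm" where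
  "pi_tm s t = f_un (f_sing s) (f_un (f_sing s) (f_sing t))"

definition tau_fun :: "t_fun \<Rightarrow> f_fun tm" where
  "tau_fun f = (case f of TBot \<Rightarrow> f_emp | TPair \<Rightarrow> pi_tm (Var 0) (Var 1))"

definition tau_rel :: "t_rel \<Rightarrow> (f_fun, f_rel) fm" where
  "tau_rel r = (case r of TSub \<Rightarrow> f_sub (Var 0) (Var 1))"

definition tau :: "(t_fun, t_rel, f_fun, f_rel) translation" where
  "tau = direct_translation (farity theory_T) tau_fun tau_rel"

end

theory Submission
  imports Defs "HOL-Library.Countable"
begin

text \<open>
  Since \<open>F\<^sup>-\<close> has finitely many axioms and a countable language, a Henkin construction shows that
  every sentence true in all its models is derivable; only finitely many variables occur at each
  stage, so variables themselves serve as Henkin witnesses. All obligations then become statements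
  about models, that is, about cancellative commutative monoids in which \<open>x + y = 0\<close> only for
  \<open>x = 0\<close> and every singleton is prime. There a singleton dividing a singleton is equal to
  it, so \<open>\<langle>x\<rangle> + \<langle>x\<rangle> + \<langle>y\<rangle>\<close> has no other singleton divisors than \<open>\<langle>x\<rangle>\<close> and \<open>\<langle>y\<rangle>\<close>, and cancelling
  recovers the ordered pair.
\<close>

section \<open>Countability of the syntax, for enumerating formulas\<close>

instance tm :: (countable) countable
  by countable_datatype

instance fm :: (countable, countable) countable
  by countable_datatype

instance f_fun :: countable
  by countable_datatype

instance f_rel :: countable
  by countable_datatype

section \<open>Substitution\<close>

lemma subst_tm_cong: "(\<And>i. i \<in> fv_tm t \<Longrightarrow> \<sigma> i = \<rho> i) \<Longrightarrow> subst_tm \<sigma> t = subst_tm \<rho> t"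
  by (induction t) auto

lemma subst_fm_cong: "(\<And>i. i \<in> fv_fm p \<Longrightarrow> \<sigma> i = \<rho> i) \<Longrightarrow> subst_fm \<sigma> p = subst_fm \<rho> p"
proof (induction p arbitrary: \<sigma> \<rho>)
  case (All p)
  have "subst_fm (up \<sigma>) p = subst_fm (up \<rho>) p"
    by (rule All.IH) (auto simp: up_def All.prems split: nat.split)
  then show ?case by simp
next
  case (Ex p)
  have "subst_fm (up \<sigma>) p = subst_fm (up \<rho>) p"
    by (rule Ex.IH) (auto simp: up_def Ex.prems split: nat.split)
  then show ?case by simp
qed (fastforce intro: subst_tm_cong)+

lemma subst_tm_Var [simp]: "subst_tm Var t = t"
  by (induction t) (simp_all add: map_idI)

lemma up_Var [simp]: "up Var = Var"
  by (auto simp: up_def fun_eq_iff split: nat.split)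

lemma subst_fm_Var [simp]: "subst_fm Var p = p"
  by (induction p) (simp_all add: map_idI)

lemma subst_tm_subst_tm: "subst_tm \<sigma> (subst_tm \<rho> t) = subst_tm (\<lambda>i. subst_tm \<sigma> (\<rho> i)) t"
  by (induction t) simp_all

lemma up_comp: "(\<lambda>i. subst_tm (up \<sigma>) (up \<rho> i)) = up (\<lambda>i. subst_tm \<sigma> (\<rho> i))"
  by (auto simp: up_def fun_eq_iff subst_tm_subst_tm split: nat.split)

lemma subst_fm_subst_fm: "subst_fm \<sigma> (subst_fm \<rho> p) = subst_fm (\<lambda>i. subst_tm \<sigma> (\<rho> i)) p"
  by (induction p arbitrary: \<sigma> \<rho>) (simp_all add: subst_tm_subst_tm up_comp)

lemma subst_fm_lift: "subst_fm (up \<sigma>) (lift_fm p) = lift_fm (subst_fm \<sigma> p)"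
  by (simp add: lift_fm_def subst_fm_subst_fm up_def)

lemma subst_fm_inst: "subst_fm \<sigma> (inst t p) = inst (subst_tm \<sigma> t) (subst_fm (up \<sigma>) p)"
  unfolding inst_def subst_fm_subst_fm
  by (intro arg_cong2[where f = subst_fm] refl)
    (auto simp: fun_eq_iff up_def subst_tm_subst_tm split: nat.split)

text \<open>The syntactic counterpart of the environment update \<open>case_nat x e\<close> in
  \<open>holds\<close>; with it the truth lemma passes through a quantifier by changing only the
  substitution.\<close>

lemma inst_subst_up: "inst t (subst_fm (up \<sigma>) p) = subst_fm (case_nat t \<sigma>) p"
  unfolding inst_def subst_fm_subst_fm
  by (intro arg_cong2[where f = subst_fm] refl)
    (auto simp: fun_eq_iff up_def subst_tm_subst_tm split: nat.split)

section \<open>Membership in the language under substitution, and free variables\<close>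

lemma tm_in_Fn [simp]:
  "tm_in U (Fn f ts) \<longleftrightarrow> length ts = farity U f \<and> (\<forall>t\<in>set ts. tm_in U t)"
  by (auto simp: list_all_iff)

declare tm_in.simps(2) [simp del]

lemma tm_in_subst: "tm_in U t \<Longrightarrow> (\<And>i. tm_in U (\<sigma> i)) \<Longrightarrow> tm_in U (subst_tm \<sigma> t)"
  by (induction t) auto

lemma tm_in_up: "(\<And>i. tm_in U (\<sigma> i)) \<Longrightarrow> tm_in U (up \<sigma> i)"
  by (auto simp: up_def intro: tm_in_subst split: nat.split)

lemma fm_in_subst: "fm_in U p \<Longrightarrow> (\<And>i. tm_in U (\<sigma> i)) \<Longrightarrow> fm_in U (subst_fm \<sigma> p)"
  by (induction p arbitrary: \<sigma>) (auto simp: list_all_iff tm_in_subst tm_in_up)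

lemma tm_in_subst_D: "tm_in U (subst_tm \<sigma> t) \<Longrightarrow> tm_in U t"
  by (induction t) auto

text \<open>Substitution keeps every symbol with its number of arguments. This recovers
  \<open>q\<close> from \<open>lift_fm q\<close> in the \<open>ExE\<close> case of
  \<open>deriv_fm_in\<close>.\<close>

lemma fm_in_subst_D: "fm_in U (subst_fm \<sigma> p) \<Longrightarrow> fm_in U p"
  by (induction p arbitrary: \<sigma>) (auto simp: list_all_iff dest: tm_in_subst_D)

lemma fm_in_inst: "fm_in U p \<Longrightarrow> tm_in U t \<Longrightarrow> fm_in U (inst t p)"
  by (auto simp: inst_def intro!: fm_in_subst split: nat.split)

lemma finite_fv_tm: "finite (fv_tm t)"
  by (induction t) auto

lemma finite_fv_fm: "finite (fv_fm p)"
  by (induction p) (auto simp: finite_fv_tm intro: finite_vimageI[of _ Suc, simplified vimage_def])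

section \<open>Admissible rules\<close>

lemma deriv_fm_in: "deriv U \<Gamma> p \<Longrightarrow> fm_in U p"
  by (induction rule: deriv.induct) (auto intro: fm_in_inst dest: fm_in_subst_D simp: lift_fm_def)

lemma deriv_mono: "deriv U \<Gamma> p \<Longrightarrow> \<Gamma> \<subseteq> \<Delta> \<Longrightarrow> deriv U \<Delta> p"
proof (induction arbitrary: \<Delta> rule: deriv.induct)
  case (DisjE \<Gamma> p q r)
  then show ?case by (meson deriv.DisjE insert_mono)
next
  case (ExE \<Gamma> p q)
  then show ?case by (meson deriv.ExE insert_mono image_mono)
next
  case (EqE p \<Gamma> s t)
  then show ?case by (meson deriv.EqE)
next
  case (AllI \<Gamma> p)
  then show ?case by (meson deriv.AllI image_mono)
next
  case (ImpE \<Gamma> p q)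
  then show ?case by (meson deriv.ImpE)
next
  case (Raa p \<Gamma>)
  then show ?case by (meson deriv.Raa insert_mono)
next
  case (ImpI p \<Gamma> q)
  then show ?case by (meson deriv.ImpI insert_mono)
qed (auto intro: deriv.intros)

text \<open>Under a binder \<open>\<sigma>\<close> becomes \<open>up \<sigma>\<close>, hence the
  induction for arbitrary \<open>\<sigma>\<close>. Serves to rename variables in a
  derivation.\<close>

lemma deriv_subst:
  "deriv U \<Gamma> p \<Longrightarrow> (\<And>i. tm_in U (\<sigma> i)) \<Longrightarrow> deriv U (subst_fm \<sigma> ` \<Gamma>) (subst_fm \<sigma> p)"
proof (induction arbitrary: \<sigma> rule: deriv.induct)
  case (AllI \<Gamma> p)
  have "deriv U (subst_fm (up \<sigma>) ` lift_fm ` \<Gamma>) (subst_fm (up \<sigma>) p)"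
    by (rule AllI.IH) (simp add: tm_in_up AllI.prems)
  then show ?case
    by (simp add: image_image subst_fm_lift deriv.AllI)
next
  case (AllE t \<Gamma> p)
  then show ?case
    by (auto simp: subst_fm_inst intro!: deriv.AllE tm_in_subst)
next
  case (ExI p t \<Gamma>)
  then show ?case
    by (auto simp: subst_fm_inst intro!: deriv.ExI[of _ _ "subst_tm \<sigma> t"] tm_in_subst fm_in_subst tm_in_up)
next
  case (ExE \<Gamma> p q)
  have "deriv U (subst_fm (up \<sigma>) ` insert p (lift_fm ` \<Gamma>)) (subst_fm (up \<sigma>) (lift_fm q))"
    by (rule ExE.IH) (simp add: tm_in_up ExE.prems)
  then have "deriv U (insert (subst_fm (up \<sigma>) p) (lift_fm ` subst_fm \<sigma> ` \<Gamma>)) (lift_fm (subst_fm \<sigma> q))"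
    by (simp add: image_image subst_fm_lift)
  moreover have "deriv U (subst_fm \<sigma> ` \<Gamma>) (Ex (subst_fm (up \<sigma>) p))"
    using ExE.IH(1)[OF ExE.prems] by simp
  ultimately show ?case by (rule deriv.ExE[rotated])
next
  case (EqE p \<Gamma> s t)
  have "fm_in U (subst_fm (up \<sigma>) p)"
    using EqE by (simp add: fm_in_subst tm_in_up)
  from deriv.EqE[OF this, of _ "subst_tm \<sigma> s" "subst_tm \<sigma> t"] EqE.IH[OF EqE.prems]
  show ?case by (simp add: subst_fm_inst)
next
  case (DisjE \<Gamma> p q r)
  then show ?case by (auto intro: deriv.DisjE)
next
  case (ImpI p \<Gamma> q)
  then show ?case using fm_in_subst[of U p \<sigma>] by (auto intro: deriv.ImpI)
next
  case (DisjI1 q \<Gamma> p)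
  then show ?case using fm_in_subst[of U q \<sigma>] by (auto intro: deriv.DisjI1)
next
  case (DisjI2 p \<Gamma> q)
  then show ?case using fm_in_subst[of U p \<sigma>] by (auto intro: deriv.DisjI2)
qed (auto intro: deriv.intros tm_in_subst fm_in_subst)

text \<open>Existential elimination with a named eigenvariable \<open>m\<close>; renaming
  \<open>m\<close> to variable 0 turns it into the de Bruijn rule \<open>ExE\<close>.\<close>

lemma deriv_fresh_witness:
  assumes Ex: "deriv U \<Gamma> (Ex p)"
    and d: "deriv U (insert (inst (Var m) p) \<Gamma>) q"
    and fresh: "\<And>r. r \<in> insert q \<Gamma> \<Longrightarrow> m \<notin> fv_fm r" "Suc m \<notin> fv_fm p"
  shows "deriv U \<Gamma> q"
proof -
  \<comment> \<open>On formulas without \<open>m\<close> this is lifting, and on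
    \<open>inst (Var m) p\<close> it undoes the instantiation. Inside \<open>p\<close>, below the
    quantifier, \<open>m\<close> has index \<open>Suc m\<close>.\<close>
  let ?\<sigma> = "\<lambda>i. if i = m then Var 0 else Var (Suc i)"
  have lift: "subst_fm ?\<sigma> r = lift_fm r" if "r \<in> insert q \<Gamma>" for r
    unfolding lift_fm_def using fresh(1)[OF that] by (intro subst_fm_cong) auto
  have "subst_fm ?\<sigma> (inst (Var m) p) = subst_fm Var p"
    unfolding inst_def subst_fm_subst_fm
    by (rule subst_fm_cong) (use fresh(2) in \<open>auto split: nat.split\<close>)
  moreover have "subst_fm ?\<sigma> ` \<Gamma> = lift_fm ` \<Gamma>"
    by (rule image_cong) (auto simp: lift)
  moreover have "deriv U (subst_fm ?\<sigma> ` insert (inst (Var m) p) \<Gamma>) (subst_fm ?\<sigma> q)"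
    by (rule deriv_subst[OF d]) simp
  ultimately have "deriv U (insert p (lift_fm ` \<Gamma>)) (lift_fm q)"
    using lift by simp
  with Ex show ?thesis by (rule deriv.ExE)
qed

text \<open>Classical duality: if no counterexample exists, \<open>Neg p\<close> is refutable for a
  generic variable 0, so \<open>Raa\<close> and \<open>AllI\<close> give
  \<open>All p\<close>.\<close>

lemma deriv_Ex_Neg:
  fixes U :: "('f, 'r) fo_theory"
  assumes "deriv U \<Gamma> (Neg (All p))"
  shows "deriv U \<Gamma> (Ex (Neg p))"
proof (rule deriv.Raa)
  have p: "fm_in U p" using deriv_fm_in[OF assms] by simp
  then show "fm_in U (Ex (Neg p))" by simp
  let ?\<Gamma> = "insert (Neg (Ex (Neg p))) \<Gamma>"
  let ?\<Delta> = "insert (Neg p) (lift_fm ` ?\<Gamma>)"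
  have lift: "lift_fm (Ex (Neg p)) = Ex (Neg (subst_fm (up (\<lambda>i. Var (Suc i))) p))"
    by (simp add: lift_fm_def)
  have fm: "fm_in U (subst_fm (up (\<lambda>i. Var (Suc i))) p)"
    using p by (rule fm_in_subst) (simp add: tm_in_up)
  \<comment> \<open>Instantiating the lifted body at \<open>Var 0\<close> is the identity
    substitution and returns \<open>p\<close>.\<close>
  have "case_nat (Var 0) (\<lambda>i. Var (Suc i)) = (Var :: nat \<Rightarrow> 'f tm)"
    by (auto simp: fun_eq_iff split: nat.split)
  then have "inst (Var 0) (Neg (subst_fm (up (\<lambda>i. Var (Suc i))) p)) = Neg p"
    using inst_subst_up[of "Var 0" "\<lambda>i. Var (Suc i)" p]
    by (simp only: inst_def subst_fm.simps subst_fm_Var)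
  then have "deriv U ?\<Delta> (Ex (Neg (subst_fm (up (\<lambda>i. Var (Suc i))) p)))"
    using p fm by (intro deriv.ExI[of _ _ "Var 0"]) (auto intro!: deriv.Assm)
  moreover have "deriv U ?\<Delta> (Neg (Ex (Neg (subst_fm (up (\<lambda>i. Var (Suc i))) p))))"
    using fm lift by (intro deriv.Assm) (auto simp: lift_fm_def)
  ultimately have "deriv U ?\<Delta> Bot" by (rule deriv.ImpE[rotated])
  then have "deriv U ?\<Gamma> (All p)"
    by (intro deriv.AllI deriv.Raa[OF p])
  with deriv_mono[OF assms] show "deriv U ?\<Gamma> Bot"
    by (meson deriv.ImpE subset_insertI)
qed

lemma deriv_explode: "deriv U \<Gamma> (Neg p) \<Longrightarrow> deriv U \<Gamma> p \<Longrightarrow> fm_in U q \<Longrightarrow> deriv U \<Gamma> q"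
  by (meson deriv.Raa deriv.ImpE deriv_mono subset_insertI)

section \<open>Completeness for finite axiom sets\<close>

primrec tval :: "('f \<Rightarrow> 'a list \<Rightarrow> 'a) \<Rightarrow> (nat \<Rightarrow> 'a) \<Rightarrow> 'f tm \<Rightarrow> 'a" where
  "tval fn e (Var i) = e i"
| "tval fn e (Fn f ts) = fn f (map (tval fn e) ts)"

text \<open>The carrier is a set \<open>D\<close> rather than a type, so that chosen representatives
  inside \<open>'f tm\<close> can form a model.\<close>

primrec holds ::
  "'a set \<Rightarrow> ('f \<Rightarrow> 'a list \<Rightarrow> 'a) \<Rightarrow> ('r \<Rightarrow> 'a list \<Rightarrow> bool) \<Rightarrow> (nat \<Rightarrow> 'a) \<Rightarrow> ('f, 'r) fm \<Rightarrow> bool"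
where
  "holds D fn rl e Bot = False"
| "holds D fn rl e (Eq s t) = (tval fn e s = tval fn e t)"
| "holds D fn rl e (Rel r ts) = rl r (map (tval fn e) ts)"
| "holds D fn rl e (Imp p q) = (holds D fn rl e p \<longrightarrow> holds D fn rl e q)"
| "holds D fn rl e (Conj p q) = (holds D fn rl e p \<and> holds D fn rl e q)"
| "holds D fn rl e (Disj p q) = (holds D fn rl e p \<or> holds D fn rl e q)"
| "holds D fn rl e (All p) = (\<forall>x\<in>D. holds D fn rl (case_nat x e) p)"
| "holds D fn rl e (Ex p) = (\<exists>x\<in>D. holds D fn rl (case_nat x e) p)"

text \<open>A complete theory with witnesses. Closure is phrased through inferences valid in every
  context, because \<open>th\<close> will be derivability from some stage of a growing chain, not
  from one fixed context.\<close>

locale henkin =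
  fixes U :: "('f, 'r) fo_theory" and th :: "('f, 'r) fm \<Rightarrow> bool"
  assumes th_fm_in: "th p \<Longrightarrow> fm_in U p"
    and th0: "(\<And>\<Gamma>. deriv U \<Gamma> p) \<Longrightarrow> th p"
    and th2: "(\<And>\<Gamma>. deriv U \<Gamma> p \<Longrightarrow> deriv U \<Gamma> q \<Longrightarrow> deriv U \<Gamma> r) \<Longrightarrow> th p \<Longrightarrow> th q \<Longrightarrow> th r"
    and not_th_Bot: "\<not> th Bot"
    and th_total: "fm_in U p \<Longrightarrow> th p \<or> th (Neg p)"
    and th_witness: "th (Ex p) \<Longrightarrow> \<exists>t. tm_in U t \<and> th (inst t p)"
begin

section \<open>Truth conditions for connectives and quantifiers\<close>

lemma th1: "(\<And>\<Gamma>. deriv U \<Gamma> p \<Longrightarrow> deriv U \<Gamma> q) \<Longrightarrow> th p \<Longrightarrow> th q"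
  using th2[of p p q] by blast

lemma th_Neg: "fm_in U p \<Longrightarrow> th (Neg p) \<longleftrightarrow> \<not> th p"
  using th_total not_th_Bot th2[of "Neg p" p Bot] deriv.ImpE by blast

lemma th_Conj: "th (Conj p q) \<longleftrightarrow> th p \<and> th q"
  using th1[of "Conj p q" p] th1[of "Conj p q" q] th2[of p q "Conj p q"]
  by (blast intro: deriv.ConjI deriv.ConjE1 deriv.ConjE2)

lemma th_Imp:
  assumes "fm_in U p" "fm_in U q"
  shows "th (Imp p q) \<longleftrightarrow> (th p \<longrightarrow> th q)"
proof
  assume "th (Imp p q)"
  then show "th p \<longrightarrow> th q" using th2[of "Imp p q" p q] deriv.ImpE by blast
next
  assume "th p \<longrightarrow> th q"
  then consider "th (Neg p)" | "th q" using th_Neg assms by blast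
  then show "th (Imp p q)"
  proof cases
    case 1
    show ?thesis
    proof (rule th1[OF _ 1])
      fix \<Gamma> assume "deriv U \<Gamma> (Neg p)"
      then have "deriv U (insert p \<Gamma>) (Neg p)" by (rule deriv_mono) blast
      then have "deriv U (insert p \<Gamma>) q"
        by (rule deriv_explode) (use assms in \<open>auto intro: deriv.Assm\<close>)
      with assms show "deriv U \<Gamma> (Imp p q)" by (blast intro: deriv.ImpI)
    qed
  next
    case 2
    show ?thesis
      by (rule th1[OF _ 2]) (meson assms deriv.ImpI deriv_mono subset_insertI)
  qed
qed

lemma th_Disj:
  assumes "fm_in U p" "fm_in U q"
  shows "th (Disj p q) \<longleftrightarrow> th p \<or> th q"
proof
  assume d: "th (Disj p q)"
  show "th p \<or> th q"
  proof (rule disjCI)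
    assume "\<not> th q"
    then have n: "th (Neg q)" using th_Neg assms by blast
    show "th p"
    proof (rule th2[OF _ d n])
      fix \<Gamma> assume a: "deriv U \<Gamma> (Disj p q)" and b: "deriv U \<Gamma> (Neg q)"
      have "deriv U (insert q \<Gamma>) (Neg q)" using b by (rule deriv_mono) blast
      then have c: "deriv U (insert q \<Gamma>) p"
        by (rule deriv_explode) (use assms in \<open>auto intro: deriv.Assm\<close>)
      show "deriv U \<Gamma> p"
        by (rule deriv.DisjE[OF a _ c]) (use assms in \<open>auto intro: deriv.Assm\<close>)
    qed
  qed
next
  assume "th p \<or> th q"
  then show "th (Disj p q)"
    using th1[of p "Disj p q"] th1[of q "Disj p q"] assms
    by (blast intro: deriv.DisjI1 deriv.DisjI2)
qed

lemma th_Ex: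
  assumes "fm_in U p"
  shows "th (Ex p) \<longleftrightarrow> (\<exists>t. tm_in U t \<and> th (inst t p))"
proof
  assume "\<exists>t. tm_in U t \<and> th (inst t p)"
  then obtain t where t: "tm_in U t" "th (inst t p)" by blast
  show "th (Ex p)" by (rule th1[OF _ t(2)]) (rule deriv.ExI[OF assms t(1)])
qed (rule th_witness)

lemma th_All:
  assumes "fm_in U p"
  shows "th (All p) \<longleftrightarrow> (\<forall>t. tm_in U t \<longrightarrow> th (inst t p))"
proof
  assume "th (All p)"
  then show "\<forall>t. tm_in U t \<longrightarrow> th (inst t p)"
    using th1[of "All p"] by (blast intro: deriv.AllE)
next
  assume all: "\<forall>t. tm_in U t \<longrightarrow> th (inst t p)"
  show "th (All p)"
  proof (rule ccontr)
    assume "\<not> th (All p)"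
    then have "th (Neg (All p))" using th_Neg[of "All p"] assms by simp
    \<comment> \<open>A failing universal yields a counterexample term through the witness
      property.\<close>
    then have "th (Ex (Neg p))" by (rule th1[rotated]) (rule deriv_Ex_Neg)
    then obtain t where t: "tm_in U t" "th (inst t (Neg p))" using th_witness by blast
    then have "th (Neg (inst t p))" by (simp add: inst_def)
    then show False using all t(1) th_Neg[of "inst t p"] fm_in_inst[OF assms t(1)] by blast
  qed
qed

section \<open>Equality in \<open>th\<close> as a congruence\<close>

lemma th_Eq_refl: "tm_in U t \<Longrightarrow> th (Eq t t)"
  by (rule th0) (rule deriv.EqI)

lemma th_Eq_inst: "th (Eq s t) \<Longrightarrow> fm_in U p \<Longrightarrow> th (inst s p) \<Longrightarrow> th (inst t p)"
  by (rule th2[of "Eq s t" "inst s p"]) (auto intro: deriv.EqE)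

lemma subst_inst_lift_tm:
  "subst_tm (case_nat t Var) (subst_tm (\<lambda>i. Var (Suc i)) s) = s"
  by (simp add: subst_tm_subst_tm)

lemma tm_in_lift: "tm_in U t \<Longrightarrow> tm_in U (subst_tm (\<lambda>i. Var (Suc i)) t)"
  by (rule tm_in_subst) simp_all

text \<open>Leibniz replacement in the formula \<open>x = s\<close>, with \<open>s\<close> lifted
  past the variable 0 that stands for \<open>x\<close>; reflexivity provides the instance at
  \<open>s\<close>.\<close>

lemma th_Eq_sym:
  assumes "th (Eq s t)"
  shows "th (Eq t s)"
  using th_Eq_inst[OF assms, of "Eq (Var 0) (subst_tm (\<lambda>i. Var (Suc i)) s)"]
    th_fm_in[OF assms] th_Eq_refl
  by (simp add: inst_def subst_inst_lift_tm tm_in_lift)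

lemma th_Eq_trans:
  assumes "th (Eq r s)" "th (Eq s t)"
  shows "th (Eq r t)"
  using th_Eq_inst[OF assms(2), of "Eq (subst_tm (\<lambda>i. Var (Suc i)) r) (Var 0)"]
    assms(1) th_fm_in[OF assms(1)]
  by (simp add: inst_def subst_inst_lift_tm tm_in_lift)

text \<open>Arguments are replaced one at a time; \<open>as\<close> is the prefix already treated
  and is generalised in the induction.\<close>

lemma th_Rel_cong:
  assumes "list_all2 (\<lambda>s t. th (Eq s t)) ts us" "th (Rel r (as @ ts))"
  shows "th (Rel r (as @ us))"
  using assms
proof (induction arbitrary: as rule: list_all2_induct)
  case (Cons t ts u us)
  let ?l = "map (subst_tm (\<lambda>i. Var (Suc i)))"
  have "th (Rel r (as @ u # ts))"
    using th_Eq_inst[OF Cons.hyps(1), of "Rel r (?l as @ Var 0 # ?l ts)"]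
      Cons.prems th_fm_in[OF Cons.prems]
    by (auto simp: inst_def subst_inst_lift_tm list_all_iff intro: tm_in_lift cong: map_cong)
  then show ?case using Cons.IH[of "as @ [u]"] by simp
qed simp

lemma th_Fn_cong_aux:
  assumes "list_all2 (\<lambda>s t. th (Eq s t)) ts us" "th (Eq x (Fn f (as @ ts)))"
  shows "th (Eq x (Fn f (as @ us)))"
  using assms
proof (induction arbitrary: as rule: list_all2_induct)
  case (Cons t ts u us)
  let ?l = "subst_tm (\<lambda>i. Var (Suc i))"
  have "th (Eq x (Fn f (as @ u # ts)))"
    using th_Eq_inst[OF Cons.hyps(1), of "Eq (?l x) (Fn f (map ?l as @ Var 0 # map ?l ts))"]
      Cons.prems th_fm_in[OF Cons.prems]
    by (auto simp: inst_def subst_inst_lift_tm intro: tm_in_lift cong: map_cong)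
  then show ?case using Cons.IH[of "as @ [u]"] by simp
qed simp

lemma th_Fn_cong:
  "tm_in U (Fn f ts) \<Longrightarrow> list_all2 (\<lambda>s t. th (Eq s t)) ts us \<Longrightarrow> th (Eq (Fn f ts) (Fn f us))"
  using th_Fn_cong_aux[of ts us "Fn f ts" f "[]"] th_Eq_refl[of "Fn f ts"] by simp

section \<open>Term model on chosen representatives\<close>

definition rep :: "'f tm \<Rightarrow> 'f tm" where
  "rep t = (SOME u. th (Eq t u))"

lemma th_Eq_rep: "tm_in U t \<Longrightarrow> th (Eq t (rep t))"
  unfolding rep_def by (rule someI) (rule th_Eq_refl)

lemma tm_in_rep: "tm_in U t \<Longrightarrow> tm_in U (rep t)"
  using th_fm_in[OF th_Eq_rep] by simp

lemma rep_eq_iff: "tm_in U s \<Longrightarrow> tm_in U t \<Longrightarrow> rep s = rep t \<longleftrightarrow> th (Eq s t)"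
proof
  assume "tm_in U s" "tm_in U t" "rep s = rep t"
  then show "th (Eq s t)" using th_Eq_rep th_Eq_sym th_Eq_trans by metis
next
  assume "th (Eq s t)"
  \<comment> \<open>Both terms admit the same candidates \<open>u\<close>, so the choice operator
    picks the same one.\<close>
  then have "th (Eq s u) \<longleftrightarrow> th (Eq t u)" for u using th_Eq_sym th_Eq_trans by blast
  then show "rep s = rep t" by (simp add: rep_def)
qed

abbreviation "hfn f xs \<equiv> rep (Fn f xs)"
abbreviation "hrl r xs \<equiv> th (Rel r xs)"
abbreviation "hdom \<equiv> rep ` {t. tm_in U t}"

lemma list_all2_rep:
  "\<forall>t\<in>set ts. tm_in U t \<Longrightarrow> list_all2 (\<lambda>s t. th (Eq s t)) ts (map rep ts)"
  by (auto simp: list_all2_conv_all_nth th_Eq_rep)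

lemma list_all2_rep':
  "\<forall>t\<in>set ts. tm_in U t \<Longrightarrow> list_all2 (\<lambda>s t. th (Eq s t)) (map rep ts) ts"
  by (auto simp: list_all2_conv_all_nth th_Eq_rep th_Eq_sym)

lemma hfn_in_hdom: "length xs = farity U f \<Longrightarrow> set xs \<subseteq> hdom \<Longrightarrow> hfn f xs \<in> hdom"
  by (rule imageI) (auto intro: tm_in_rep)

text \<open>Congruence absorbs that \<open>hfn\<close> receives representatives in place of the
  argument terms.\<close>

lemma tval_rep:
  "tm_in U t \<Longrightarrow> (\<And>i. tm_in U (\<sigma> i)) \<Longrightarrow> tval hfn (\<lambda>i. rep (\<sigma> i)) t = rep (subst_tm \<sigma> t)"
proof (induction t)
  case (Fn f ts)
  let ?us = "map (subst_tm \<sigma>) ts"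
  have in': "\<forall>t\<in>set ?us. tm_in U t" "tm_in U (Fn f ?us)"
    using Fn.prems by (auto intro: tm_in_subst)
  have "map (tval hfn (\<lambda>i. rep (\<sigma> i))) ts = map rep ?us"
    using Fn by simp
  moreover have "rep (Fn f (map rep ?us)) = rep (Fn f ?us)"
    using th_Fn_cong[OF in'(2) list_all2_rep[OF in'(1)]] th_Eq_sym
    by (subst rep_eq_iff) (use in' in \<open>auto intro: tm_in_rep\<close>)
  ultimately show ?case by (simp only: tval.simps subst_tm.simps)
qed simp

text \<open>Generalised over \<open>\<sigma>\<close> so that a quantifier case can use the
  hypothesis at \<open>case_nat t \<sigma>\<close>; the elements of \<open>hdom\<close> are exactly
  the \<open>rep t\<close>.\<close>

lemma truth:
  "fm_in U p \<Longrightarrow> (\<And>i. tm_in U (\<sigma> i)) \<Longrightarrow>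
    holds hdom hfn hrl (\<lambda>i. rep (\<sigma> i)) p \<longleftrightarrow> th (subst_fm \<sigma> p)"
proof (induction p arbitrary: \<sigma>)
  case Bot
  then show ?case by (simp add: not_th_Bot)
next
  case (Eq s t)
  then show ?case by (simp add: tval_rep rep_eq_iff tm_in_subst)
next
  case (Rel r ts)
  let ?us = "map (subst_tm \<sigma>) ts"
  have in': "\<forall>t\<in>set ?us. tm_in U t"
    using Rel.prems by (auto simp: list_all_iff intro: tm_in_subst)
  have "map (tval hfn (\<lambda>i. rep (\<sigma> i))) ts = map rep ?us"
    using Rel.prems by (auto simp: tval_rep list_all_iff)
  moreover have "th (Rel r (map rep ?us)) \<longleftrightarrow> th (Rel r ?us)"
    using th_Rel_cong[OF list_all2_rep[OF in'], of r "[]"]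
      th_Rel_cong[OF list_all2_rep'[OF in'], of r "[]"] by auto
  ultimately show ?case by (simp only: holds.simps subst_fm.simps)
next
  case (Imp p q)
  then show ?case by (simp add: th_Imp fm_in_subst)
next
  case (Conj p q)
  then show ?case by (simp add: th_Conj)
next
  case (Disj p q)
  then show ?case by (simp add: th_Disj fm_in_subst)
next
  case (All p)
  have "holds hdom hfn hrl (case_nat (rep t) (\<lambda>i. rep (\<sigma> i))) p \<longleftrightarrow> th (inst t (subst_fm (up \<sigma>) p))"
    if "tm_in U t" for t
  proof -
    have "case_nat (rep t) (\<lambda>i. rep (\<sigma> i)) = (\<lambda>i. rep (case_nat t \<sigma> i))"
      by (auto split: nat.split)
    then show ?thesis
      using All.IH[of "case_nat t \<sigma>"] All.prems that by (simp add: inst_subst_up split: nat.split)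
  qed
  then show ?case
    using All.prems by (simp add: th_All fm_in_subst tm_in_up)
next
  case (Ex p)
  have "holds hdom hfn hrl (case_nat (rep t) (\<lambda>i. rep (\<sigma> i))) p \<longleftrightarrow> th (inst t (subst_fm (up \<sigma>) p))"
    if "tm_in U t" for t
  proof -
    have "case_nat (rep t) (\<lambda>i. rep (\<sigma> i)) = (\<lambda>i. rep (case_nat t \<sigma> i))"
      by (auto split: nat.split)
    then show ?thesis
      using Ex.IH[of "case_nat t \<sigma>"] Ex.prems that by (simp add: inst_subst_up split: nat.split)
  qed
  then show ?case
    using Ex.prems by (auto simp add: th_Ex fm_in_subst tm_in_up)
qed

end

section \<open>Lindenbaum-Henkin extension of a finite consistent set\<close>

definition consistent :: "('f, 'r) fo_theory \<Rightarrow> ('f, 'r) fm set \<Rightarrow> bool" where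
  "consistent U \<Gamma> \<longleftrightarrow> finite \<Gamma> \<and> (\<forall>q\<in>\<Gamma>. fm_in U q) \<and> \<not> deriv U \<Gamma> Bot"

lemma consistent_extend:
  assumes "consistent U \<Gamma>"
  shows "\<exists>\<Delta>. consistent U \<Delta> \<and> \<Gamma> \<subseteq> \<Delta> \<and> (consistent U (insert q \<Gamma>) \<longrightarrow>
    q \<in> \<Delta> \<and> (\<forall>p. q = Ex p \<longrightarrow> (\<exists>t. tm_in U t \<and> inst t p \<in> \<Delta>)))"
proof (cases "consistent U (insert q \<Gamma>)")
  case c: True
  show ?thesis
  proof (cases "\<exists>p. q = Ex p")
    case True
    then obtain p where p: "q = Ex p" by blast
    define A where "A = \<Union> (fv_fm ` insert q \<Gamma>) \<union> fv_fm p"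
    have "finite A"
      using c by (auto simp: A_def consistent_def finite_fv_fm)
    then obtain m where "\<forall>i\<in>A. i < m" using finite_nat_set_iff_bounded by blast
    then have m: "m \<notin> A" "Suc m \<notin> A" by auto
    let ?\<Delta> = "insert (inst (Var m) p) (insert q \<Gamma>)"
    have q: "fm_in U q" using c by (simp add: consistent_def)
    have "\<not> deriv U ?\<Delta> Bot"
    proof
      assume d: "deriv U ?\<Delta> Bot"
      have "deriv U (insert q \<Gamma>) Bot"
      proof (rule deriv_fresh_witness[OF _ d])
        show "deriv U (insert q \<Gamma>) (Ex p)" using p q by (auto intro: deriv.Assm)
      qed (use m in \<open>auto simp: A_def\<close>)
      with c show False by (simp add: consistent_def)
    qed
    moreover have "fm_in U (inst (Var m) p)" using p q by (auto intro: fm_in_inst)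
    ultimately have "consistent U ?\<Delta>" using c by (simp add: consistent_def)
    then show ?thesis
      by (intro exI[of _ ?\<Delta>]) (use p in \<open>auto intro!: exI[of _ "Var m"]\<close>)
  next
    case False
    then show ?thesis using c by blast
  qed
next
  case False
  then show ?thesis using assms by blast
qed

lemma henkin_extension:
  fixes U :: "('f::countable, 'r::countable) fo_theory"
  assumes "consistent U \<Gamma>"
  shows "\<exists>th. henkin U th \<and> (\<forall>q\<in>\<Gamma>. th q)"
proof -
  \<comment> \<open>Stage \<open>n\<close> treats the formula coded by \<open>n\<close>; the clause
    for \<open>n = 0\<close> makes the chain start at \<open>\<Gamma>\<close>.\<close>
  have "\<exists>S. \<forall>n. (consistent U (S n) \<and> (n = 0 \<longrightarrow> S n = \<Gamma>)) \<and>
      S n \<subseteq> S (Suc n) \<and> (consistent U (insert (from_nat n) (S n)) \<longrightarrow>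
      from_nat n \<in> S (Suc n) \<and> (\<forall>p. from_nat n = Ex p \<longrightarrow> (\<exists>t. tm_in U t \<and> inst t p \<in> S (Suc n))))"
  proof (rule dependent_nat_choice)
    show "\<exists>\<Delta>. consistent U \<Delta> \<and> (0 = 0 \<longrightarrow> \<Delta> = \<Gamma>)" using assms by blast
  next
    fix \<Delta> :: "('f, 'r) fm set" and n :: nat
    assume "consistent U \<Delta> \<and> (n = 0 \<longrightarrow> \<Delta> = \<Gamma>)"
    then show "\<exists>\<Delta>'. (consistent U \<Delta>' \<and> (Suc n = 0 \<longrightarrow> \<Delta>' = \<Gamma>)) \<and> \<Delta> \<subseteq> \<Delta>' \<and>
        (consistent U (insert (from_nat n) \<Delta>) \<longrightarrow> from_nat n \<in> \<Delta>' \<and>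
          (\<forall>p. from_nat n = Ex p \<longrightarrow> (\<exists>t. tm_in U t \<and> inst t p \<in> \<Delta>')))"
      using consistent_extend[of U \<Delta> "from_nat n"] by auto
  qed
  then obtain S where S_con: "\<And>n. consistent U (S n)" and S0: "S 0 = \<Gamma>"
    and S_Suc: "\<And>n. S n \<subseteq> S (Suc n)"
    and S_step: "\<And>q. consistent U (insert q (S (to_nat q))) \<Longrightarrow>
      q \<in> S (Suc (to_nat q)) \<and> (\<forall>p. q = Ex p \<longrightarrow> (\<exists>t. tm_in U t \<and> inst t p \<in> S (Suc (to_nat q))))"
    by (metis from_nat_to_nat)
  have S_mono: "S m \<subseteq> S n" if "m \<le> n" for m n
    using S_Suc that by (rule lift_Suc_mono_le)
  \<comment> \<open>Derivability from some finite stage; two premises meet at the later of their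
    stages.\<close>
  define th where "th p \<longleftrightarrow> (\<exists>n. deriv U (S n) p)" for p
  have th_mem: "th q" if "q \<in> S n" for q n
    using that S_con[of n] by (auto simp: th_def consistent_def intro: deriv.Assm)
  have th2: "th r" if "\<And>\<Gamma>. deriv U \<Gamma> p \<Longrightarrow> deriv U \<Gamma> q \<Longrightarrow> deriv U \<Gamma> r" "th p" "th q" for p q r
  proof -
    obtain m n where "deriv U (S m) p" "deriv U (S n) q" using \<open>th p\<close> \<open>th q\<close> th_def by blast
    then have "deriv U (S (max m n)) p" "deriv U (S (max m n)) q"
      by (meson deriv_mono S_mono max.cobounded1 max.cobounded2)+
    then show ?thesis using that(1) th_def by blast
  qed
  have not_Bot: "\<not> th Bot" using S_con by (simp add: th_def consistent_def)
  have total: "th (Neg q)" if "fm_in U q" "\<not> consistent U (insert q (S (to_nat q)))" for q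
  proof -
    have "deriv U (insert q (S (to_nat q))) Bot"
      using that S_con[of "to_nat q"] by (simp add: consistent_def)
    then show ?thesis using that(1) th_def deriv.ImpI by blast
  qed
  have "henkin U th"
  proof
    show "fm_in U p" if "th p" for p using that deriv_fm_in th_def by blast
    show "th p" if "\<And>\<Gamma>. deriv U \<Gamma> p" for p using that th_def by blast
    show "th r" if "\<And>\<Gamma>. deriv U \<Gamma> p \<Longrightarrow> deriv U \<Gamma> q \<Longrightarrow> deriv U \<Gamma> r" "th p" "th q" for p q r
      using that by (rule th2)
    show "\<not> th Bot" by (rule not_Bot)
    show "th p \<or> th (Neg p)" if "fm_in U p" for p
      using total[OF that] S_step[of p] th_mem by blast
    show "\<exists>t. tm_in U t \<and> th (inst t p)" if "th (Ex p)" for p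
    proof -
      have "fm_in U (Ex p)" using that deriv_fm_in th_def by blast
      \<comment> \<open>\<open>Ex p\<close> may become derivable only after its own stage. Had it
        been rejected there, its negation would be in \<open>th\<close> too; so it was accepted and
        received a witness.\<close>
      moreover have "\<not> th (Neg (Ex p))"
        using th2[of "Neg (Ex p)" "Ex p" Bot] that not_Bot deriv.ImpE by blast
      ultimately show ?thesis using total[of "Ex p"] S_step[of "Ex p"] th_mem by blast
    qed
  qed
  then show ?thesis using th_mem[of _ 0] S0 by blast
qed

text \<open>The term model lives on type \<^typ>\<open>'f tm\<close>, so it suffices to quantify over models there.\<close>

theorem finite_completeness:
  fixes U :: "('f::countable, 'r::countable) fo_theory"
  assumes fin: "finite \<Gamma>" and fm: "\<And>q. q \<in> \<Gamma> \<Longrightarrow> fm_in U q" "fm_in U p"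
    and valid: "\<And>(D :: 'f tm set) fn rl e.
      (\<And>f xs. length xs = farity U f \<Longrightarrow> set xs \<subseteq> D \<Longrightarrow> fn f xs \<in> D) \<Longrightarrow> (\<And>i. e i \<in> D) \<Longrightarrow>
      (\<And>q. q \<in> \<Gamma> \<Longrightarrow> holds D fn rl e q) \<Longrightarrow> holds D fn rl e p"
  shows "deriv U \<Gamma> p"
proof (rule ccontr)
  assume "\<not> deriv U \<Gamma> p"
  then have "consistent U (insert (Neg p) \<Gamma>)"
    using fin fm deriv.Raa[of U p \<Gamma>] by (auto simp: consistent_def)
  then obtain th where "henkin U th" and th: "\<forall>q\<in>insert (Neg p) \<Gamma>. th q"
    using henkin_extension by blast
  then interpret henkin U th by simp
  have "holds hdom hfn hrl (\<lambda>i. rep (Var i)) p"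
  proof (rule valid)
    show "holds hdom hfn hrl (\<lambda>i. rep (Var i)) q" if "q \<in> \<Gamma>" for q
      using truth[of q Var] fm(1)[OF that] th that by simp
  qed (auto intro: hfn_in_hdom)
  then have "th p" using truth[of p Var] fm(2) by simp
  then show False using th th_Neg[OF fm(2)] by simp
qed

section \<open>Models of \<open>F\<^sup>-\<close>\<close>

locale fminus_model =
  fixes D :: "'a set" and emp :: 'a and sing :: "'a \<Rightarrow> 'a" and un :: "'a \<Rightarrow> 'a \<Rightarrow> 'a"
    and sub :: "'a \<Rightarrow> 'a \<Rightarrow> bool"
  assumes emp_in [simp]: "emp \<in> D"
    and sing_in [simp]: "x \<in> D \<Longrightarrow> sing x \<in> D"
    and un_in [simp]: "x \<in> D \<Longrightarrow> y \<in> D \<Longrightarrow> un x y \<in> D"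
    and un_assoc: "x \<in> D \<Longrightarrow> y \<in> D \<Longrightarrow> z \<in> D \<Longrightarrow> un (un x y) z = un x (un y z)"
    and un_comm: "x \<in> D \<Longrightarrow> y \<in> D \<Longrightarrow> un x y = un y x"
    and un_emp: "x \<in> D \<Longrightarrow> un x emp = x"
    and un_cancel: "x \<in> D \<Longrightarrow> y \<in> D \<Longrightarrow> z \<in> D \<Longrightarrow> un x z = un y z \<Longrightarrow> x = y"
    and sing_neq_emp: "x \<in> D \<Longrightarrow> sing x \<noteq> emp"
    and un_eq_emp: "x \<in> D \<Longrightarrow> y \<in> D \<Longrightarrow> un x y = emp \<Longrightarrow> x = emp"
    and sing_inj: "x \<in> D \<Longrightarrow> y \<in> D \<Longrightarrow> sing x = sing y \<Longrightarrow> x = y"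
    and sing_prime: "u \<in> D \<Longrightarrow> v \<in> D \<Longrightarrow> x \<in> D \<Longrightarrow> w \<in> D \<Longrightarrow> un u v = un (sing x) w \<Longrightarrow>
      \<exists>w'\<in>D. u = un (sing x) w' \<or> v = un (sing x) w'"
    and sub_iff: "x \<in> D \<Longrightarrow> t \<in> D \<Longrightarrow>
      sub x t \<longleftrightarrow> x = t \<or> (\<exists>w\<in>D. \<exists>u\<in>D. t = un w (sing u) \<and> sub x u)"
begin

lemma un_cancel_left: "x \<in> D \<Longrightarrow> y \<in> D \<Longrightarrow> z \<in> D \<Longrightarrow> un z x = un z y \<Longrightarrow> x = y"
  using un_cancel un_comm by metis

text \<open>
  Primality of \<open>sing a\<close> (the axiom \<open>F\<^sub>8\<close>) makes divisibility between singletons mutual, and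
  positivity of the cancellative monoid then forces the cofactors to be empty.
\<close>

lemma sing_dvd_sing:
  assumes "a \<in> D" "b \<in> D" "w \<in> D" "sing a = un (sing b) w"
  shows "a = b"
proof -
  have absorb: "v = emp" if "x \<in> D" "v \<in> D" "un x v = x" for x v
    using that un_cancel_left[of v emp x] by (simp add: un_emp)
  \<comment> \<open>\<open>sing a\<close> divides itself with cofactor \<open>emp\<close>, so
    primality applies to the sum \<open>un (sing b) w\<close>.\<close>
  obtain w' where w': "w' \<in> D" "sing b = un (sing a) w' \<or> w = un (sing a) w'"
    using sing_prime[of "sing b" w a emp] assms by (auto simp: un_emp)
  from w'(2) show ?thesis
  proof
    assume eq: "sing b = un (sing a) w'"
    have "un (sing b) (un w w') = un (un (sing b) w) w'"
      using assms w'(1) by (simp only: un_assoc sing_in)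
    also have "\<dots> = sing b" by (simp only: assms(4)[symmetric] eq[symmetric])
    finally have "un w w' = emp"
      by (rule absorb[rotated 2]) (use assms(1-3) w'(1) in simp_all)
    then have "w = emp" using un_eq_emp assms w'(1) by blast
    then have "sing a = sing b" using assms by (simp add: un_emp)
    then show ?thesis using assms sing_inj by blast
  next
    \<comment> \<open>Here \<open>sing a\<close> absorbs \<open>un (sing b) w'\<close>, which would
      make \<open>sing b\<close> empty.\<close>
    assume eq: "w = un (sing a) w'"
    have "un (sing a) (un (sing b) w') = un (sing a) (un w' (sing b))"
      using assms(1-3) w'(1) un_comm[of "sing b" w'] by simp
    also have "\<dots> = un w (sing b)"
      unfolding eq using assms(1,2) w'(1) by (simp only: un_assoc sing_in)
    also have "\<dots> = sing a"
      using assms(2,3) un_comm[of w "sing b"] unfolding assms(4) by simp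
    finally have "un (sing b) w' = emp"
      by (rule absorb[rotated 2]) (use assms(1-3) w'(1) in simp_all)
    then show ?thesis using un_eq_emp[of "sing b" w'] sing_neq_emp assms(1-3) w'(1) by simp
  qed
qed

text \<open>The first component is doubled: multiplicity records the order that
  \<open>un_comm\<close> would lose.\<close>

abbreviation pair :: "'a \<Rightarrow> 'a \<Rightarrow> 'a" where
  "pair x y \<equiv> un (sing x) (un (sing x) (sing y))"

lemma sing_dvd_pair:
  assumes "x \<in> D" "y \<in> D" "u \<in> D" "w \<in> D" "pair x y = un (sing u) w"
  shows "u = x \<or> u = y"
proof (rule disjCI)
  assume "u \<noteq> y"
  show "u = x"
  proof (rule ccontr)
    assume "u \<noteq> x"
    then have no: "\<not> (\<exists>w'\<in>D. sing x = un (sing u) w')" "\<not> (\<exists>w'\<in>D. sing y = un (sing u) w')"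
      using assms \<open>u \<noteq> y\<close> sing_dvd_sing by metis+
    \<comment> \<open>Primality is applied to the outer sum, then to the inner one, so
      \<open>sing u\<close> divides one of the summands.\<close>
    then obtain w' where "w' \<in> D" "un (sing x) (sing y) = un (sing u) w'"
      using sing_prime[of "sing x" "un (sing x) (sing y)" u w] assms by auto
    then show False using sing_prime[of "sing x" "sing y" u w'] assms no by auto
  qed
qed

lemma pair_neq_emp: "x \<in> D \<Longrightarrow> y \<in> D \<Longrightarrow> pair x y \<noteq> emp"
  using un_eq_emp[of "sing x" "un (sing x) (sing y)"] sing_neq_emp by auto

lemma pair_inj:
  assumes D: "x \<in> D" "y \<in> D" "z \<in> D" "w \<in> D" and eq: "pair x y = pair z w"
  shows "x = z \<and> y = w"
proof -
  have "x = z"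
  proof (rule ccontr)
    assume "x \<noteq> z"
    \<comment> \<open>\<open>sing x\<close> divides \<open>pair z w\<close>, and \<open>z\<close> is
      ruled out. Cancelling one \<open>sing x\<close> then equates \<open>sing x\<close> plus
      \<open>sing y\<close> with twice \<open>sing z\<close>, so \<open>sing x\<close> divides
      \<open>sing z\<close> by primality.\<close>
    then have "x = w"
      using sing_dvd_pair[of z w x "un (sing x) (sing y)"] D eq by simp
    then have "pair x y = un (sing x) (un (sing z) (sing z))"
      using D eq un_assoc[of "sing z" "sing z" "sing x"] un_comm[of "un (sing z) (sing z)" "sing x"]
      by simp
    then have "un (sing x) (sing y) = un (sing z) (sing z)"
      using D by (meson sing_in un_cancel_left un_in)
    then obtain w' where "w' \<in> D" "sing z = un (sing x) w'"
      using sing_prime[of "sing z" "sing z" x "sing y"] D by auto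
    then show False using sing_dvd_sing[of z x w'] D \<open>x \<noteq> z\<close> by auto
  qed
  then have "sing y = sing w" using eq D by (meson sing_in un_cancel_left un_in)
  then show ?thesis using \<open>x = z\<close> D sing_inj by blast
qed

text \<open>The recursive alternative of \<open>sub_iff\<close> would write \<open>emp\<close> as a
  sum with a singleton summand, which positivity excludes.\<close>

lemma sub_emp: "x \<in> D \<Longrightarrow> sub x emp \<longleftrightarrow> x = emp"
  using sub_iff[of x emp] un_eq_emp un_comm sing_neq_emp sing_in emp_in by metis

lemma sub_pair:
  assumes D: "x \<in> D" "y \<in> D" "z \<in> D"
  shows "sub x (pair y z) \<longleftrightarrow> x = pair y z \<or> sub x y \<or> sub x z"
proof -
  have "u = y \<or> u = z" if "w \<in> D" "u \<in> D" "pair y z = un w (sing u)" for w u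
    using sing_dvd_pair[of y z u w] that D un_comm[of w "sing u"] by simp
  \<comment> \<open>Explicit cofactors, in the shape that \<open>sub_iff\<close> asks for, showing
    that \<open>y\<close> and \<open>z\<close> both occur.\<close>
  moreover have "pair y z = un (un (sing y) (sing z)) (sing y)"
    using D by (intro un_comm) simp_all
  moreover have "pair y z = un (un (sing y) (sing y)) (sing z)"
    using D by (simp add: un_assoc)
  ultimately show ?thesis
    using sub_iff[of x "pair y z"] D by (metis sing_in un_in)
qed

end

section \<open>From satisfied axioms to the algebraic model, and back to provability\<close>

lemma fminus_model_holds:
  fixes fn :: "f_fun \<Rightarrow> 'a list \<Rightarrow> 'a" and e :: "nat \<Rightarrow> 'a"
  assumes fn: "\<And>f xs. length xs = farity theory_Fminus f \<Longrightarrow> set xs \<subseteq> D \<Longrightarrow> fn f xs \<in> D"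
    and ax: "\<And>q. q \<in> axioms theory_Fminus \<Longrightarrow> holds D fn rl e q"
  shows "fminus_model D (fn FEmp []) (\<lambda>x. fn FSing [x]) (\<lambda>x y. fn FUn [x, y]) (\<lambda>x y. rl FSub [x, y])"
proof -
  note defs = Alls_def numeral_eq_Suc Let_def
  have F: "holds D fn rl e F1" "holds D fn rl e F2" "holds D fn rl e F3" "holds D fn rl e F4"
    "holds D fn rl e F5" "holds D fn rl e F6" "holds D fn rl e F7" "holds D fn rl e F8"
    "holds D fn rl e F9"
    by (rule ax; simp add: theory_Fminus_def)+
  show ?thesis
  proof (unfold_locales, goal_cases)
    case 1 show ?case by (rule fn) (simp_all add: theory_Fminus_def)
  next
    case (2 x) then show ?case by (intro fn) (simp_all add: theory_Fminus_def)
  next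
    case (3 x y) then show ?case by (intro fn) (simp_all add: theory_Fminus_def)
  next
    case (4 x y z) then show ?case using F(1) by (simp add: F1_def defs)
  next
    case (5 x y)
    have "\<forall>x\<in>D. \<forall>y\<in>D. fn FUn [x, y] = fn FUn [y, x]" using F(2) by (simp add: F2_def defs)
    with 5 show ?case by blast
  next
    case (6 x) then show ?case using F(3) by (simp add: F3_def defs)
  next
    case (7 x y z) then show ?case using F(4) by (simp add: F4_def defs) blast
  next
    case (8 x) then show ?case using F(5) by (simp add: F5_def defs)
  next
    case (9 x y) then show ?case using F(6) by (simp add: F6_def defs) blast
  next
    case (10 x y) then show ?case using F(7) by (simp add: F7_def defs)
  next
    case (11 u v x w) then show ?case using F(8) by (simp add: F8_def defs) blast
  next
    case (12 x t)
    \<comment> \<open>\<open>Iff\<close> is a conjunction of two implications;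
      \<open>iff_conv_conj_imp\<close> gives the equivalence the same form.\<close>
    have "\<forall>x\<in>D. \<forall>t\<in>D. rl FSub [x, t] \<longleftrightarrow>
        x = t \<or> (\<exists>w\<in>D. \<exists>u\<in>D. t = fn FUn [w, fn FSing [u]] \<and> rl FSub [x, u])"
      using F(9) by (simp add: F9_def defs iff_conv_conj_imp)
    with 12 show ?case by simp
  qed
qed

text \<open>Completeness moves every later provability goal into the algebra; carriers inside
  \<open>f_fun tm\<close> suffice, the type of the term model.\<close>

lemma proves_theory_FminusI:
  assumes "fm_in theory_Fminus p"
    and valid: "\<And>(D :: f_fun tm set) fn rl e.
      fminus_model D (fn FEmp []) (\<lambda>x. fn FSing [x]) (\<lambda>x y. fn FUn [x, y]) (\<lambda>x y. rl FSub [x, y]) \<Longrightarrow>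
      (\<And>i. e i \<in> D) \<Longrightarrow> holds D fn rl e p"
  shows "proves theory_Fminus p"
  unfolding proves_def
proof (rule finite_completeness)
  show "finite (axioms theory_Fminus)" by (simp add: theory_Fminus_def)
  show "fm_in theory_Fminus q" if "q \<in> axioms theory_Fminus" for q
    using that
    by (auto simp: theory_Fminus_def F1_def F2_def F3_def F4_def F5_def F6_def F7_def F8_def
        F9_def Alls_def numeral_eq_Suc Let_def)
qed (use assms fminus_model_holds in \<open>blast+\<close>)

section \<open>The interpretation\<close>

lemmas syntax_defs = Alls_def Exs_def Conjs_def Let_def numeral_eq_Suc theory_Fminus_def
  theory_T_def T1_def T2_def T3_def T4_def tau_fun_def tau_rel_def pi_tm_def
  tau_def direct_translation_def app_def args_def in_dom_def tr_atom_def up_def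
  fun_total_def fun_unique_def congruence_def

text \<open>Translated pairing evaluates to \<open>pair\<close>, so the axioms reduce to
  \<open>pair_neq_emp\<close>, \<open>pair_inj\<close>, \<open>sub_emp\<close> and
  \<open>sub_pair\<close>.\<close>

lemma proves_direct_tr:
  assumes "p \<in> {T1, T2, T3, T4}"
  shows "proves theory_Fminus (direct_tr tau_fun tau_rel p)"
proof (rule proves_theory_FminusI)
  have "fm_in theory_Fminus (direct_tr tau_fun tau_rel T1)" "fm_in theory_Fminus (direct_tr tau_fun tau_rel T2)"
    "fm_in theory_Fminus (direct_tr tau_fun tau_rel T3)" "fm_in theory_Fminus (direct_tr tau_fun tau_rel T4)"
    by (simp_all add: syntax_defs)
  then show "fm_in theory_Fminus (direct_tr tau_fun tau_rel p)" using assms by blast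
next
  fix D :: "f_fun tm set" and fn rl e
  assume "fminus_model D (fn FEmp []) (\<lambda>x. fn FSing [x]) (\<lambda>x y. fn FUn [x, y]) (\<lambda>x y. rl FSub [x, y])"
  then interpret fminus_model D "fn FEmp []" "\<lambda>x. fn FSing [x]" "\<lambda>x y. fn FUn [x, y]" "\<lambda>x y. rl FSub [x, y]" .
  have "holds D fn rl e (direct_tr tau_fun tau_rel T1)"
    using pair_neq_emp by (simp add: syntax_defs)
  moreover have "holds D fn rl e (direct_tr tau_fun tau_rel T2)"
    by (simp add: syntax_defs) (use pair_inj in blast)
  moreover have "holds D fn rl e (direct_tr tau_fun tau_rel T3)"
    using sub_emp by (simp add: syntax_defs)
  moreover have "holds D fn rl e (direct_tr tau_fun tau_rel T4)"
    using sub_pair by (simp add: syntax_defs)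
  ultimately show "holds D fn rl e (direct_tr tau_fun tau_rel p)" using assms by blast
qed

text \<open>Each graph formula fixes its value, which lies in \<open>D\<close> by closure; the
  quantifiers introduced by unnesting collapse and the same four facts remain.\<close>

lemma proves_tr:
  assumes "p \<in> {T1, T2, T3, T4}"
  shows "proves theory_Fminus (tr tau p)"
proof (rule proves_theory_FminusI)
  have "fm_in theory_Fminus (tr tau T1)" "fm_in theory_Fminus (tr tau T2)"
    "fm_in theory_Fminus (tr tau T3)" "fm_in theory_Fminus (tr tau T4)"
    by (simp_all add: syntax_defs)
  then show "fm_in theory_Fminus (tr tau p)" using assms by blast
next
  fix D :: "f_fun tm set" and fn rl e
  assume "fminus_model D (fn FEmp []) (\<lambda>x. fn FSing [x]) (\<lambda>x y. fn FUn [x, y]) (\<lambda>x y. rl FSub [x, y])"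
  then interpret fminus_model D "fn FEmp []" "\<lambda>x. fn FSing [x]" "\<lambda>x y. fn FUn [x, y]" "\<lambda>x y. rl FSub [x, y]" .
  have "holds D fn rl e (tr tau T1)"
    using pair_neq_emp by (simp add: syntax_defs)
  moreover have "holds D fn rl e (tr tau T2)"
    by (simp add: syntax_defs) (use pair_inj in blast)
  moreover have "holds D fn rl e (tr tau T3)"
    using sub_emp by (simp add: syntax_defs)
  moreover have "holds D fn rl e (tr tau T4)"
    using sub_pair by (simp add: syntax_defs)
  ultimately show "holds D fn rl e (tr tau p)" using assms by blast
qed

section \<open>Remaining conditions for a direct interpretation\<close>

lemma translation_ok_tau: "translation_ok tau theory_T theory_Fminus"
proof -
  have "fm_in theory_Fminus (tfun tau f) \<and> fv_fm (tfun tau f) \<subseteq> {..farity theory_T f}" for f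
    by (cases f) (simp_all add: syntax_defs)
  moreover have "fm_in theory_Fminus (trel tau r) \<and> fv_fm (trel tau r) \<subseteq> {..<rarity theory_T r}" for r
    by (cases r) (simp_all add: syntax_defs)
  ultimately show ?thesis by (simp add: translation_ok_def) (simp add: syntax_defs)
qed

lemma direct_tau: "direct tau theory_T theory_Fminus"
proof -
  have "tm_in theory_Fminus (tau_fun f) \<and> fv_tm (tau_fun f) \<subseteq> {..<farity theory_T f} \<and>
      tfun tau f = Eq (Var (farity theory_T f)) (tau_fun f)" for f
    by (cases f) (simp_all add: syntax_defs)
  then show ?thesis unfolding direct_def by (auto simp: tau_def direct_translation_def)
qed

lemma proves_fun_total: "proves theory_Fminus (fun_total tau (farity theory_T f) (tfun tau f))"
proof (rule proves_theory_FminusI)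
  show "fm_in theory_Fminus (fun_total tau (farity theory_T f) (tfun tau f))"
    by (cases f) (simp_all add: syntax_defs)
next
  fix D :: "f_fun tm set" and fn rl e
  assume "fminus_model D (fn FEmp []) (\<lambda>x. fn FSing [x]) (\<lambda>x y. fn FUn [x, y]) (\<lambda>x y. rl FSub [x, y])"
  then interpret fminus_model D "fn FEmp []" "\<lambda>x. fn FSing [x]" "\<lambda>x y. fn FUn [x, y]" "\<lambda>x y. rl FSub [x, y]" .
  show "holds D fn rl e (fun_total tau (farity theory_T f) (tfun tau f))"
    by (cases f) (simp_all add: syntax_defs)
qed

lemma proves_fun_unique: "proves theory_Fminus (fun_unique tau (farity theory_T f) (tfun tau f))"
  by (cases f) (rule proves_theory_FminusI; simp add: syntax_defs)+

text \<open>\<open>teq\<close> is genuine equality, so these conditions hold in every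
  structure.\<close>

lemma equality_ok_tau: "equality_ok tau theory_T theory_Fminus"
proof -
  have rel_cong: "proves theory_Fminus (congruence tau (rarity theory_T r) (trel tau r))" for r
    by (cases r) (rule proves_theory_FminusI; simp add: syntax_defs)
  have fun_cong: "proves theory_Fminus (congruence tau (Suc (farity theory_T f)) (tfun tau f))" for f
    by (cases f) (rule proves_theory_FminusI; simp add: syntax_defs)+
  show ?thesis
    unfolding equality_ok_def
    by (intro conjI allI rel_cong fun_cong) (rule proves_theory_FminusI; simp add: syntax_defs)+
qed

lemma interpretation_of_tau: "interpretation_of tau theory_T theory_Fminus"
proof -
  have "proves theory_Fminus (Ex (tdom tau))"
    by (rule proves_theory_FminusI) (auto simp: tau_def direct_translation_def)
  moreover have "axioms theory_T = {T1, T2, T3, T4}" by (simp add: theory_T_def)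
  ultimately show ?thesis
    unfolding interpretation_of_def
    using translation_ok_tau proves_fun_total proves_fun_unique equality_ok_tau proves_tr by blast
qed

text \<open>The axioms are covered in two renderings: \<open>direct_tr\<close> replaces symbols
  inside terms, while \<open>interpretation_of\<close> uses the unnested translation
  \<open>tr\<close>.\<close>

theorem theorem4p3:
  shows "(\<forall>p \<in> {T1, T2, T3, T4}. proves theory_Fminus (direct_tr tau_fun tau_rel p)) \<and>
    direct_interpretation_of tau theory_T theory_Fminus \<and>
    interpretable theory_T theory_Fminus"
  using proves_direct_tr interpretation_of_tau direct_tau
  unfolding direct_interpretation_of_def interpretable_def by blast

end
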